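(* Let $X$ be a compact complex manifold of dimension $k$ and let $f:X\to X$ be a dominating meromorphic map. Then $$h^{top}_{(k,0)}(f)=h_{top}(f).$$
   Context: $I$ is the indeterminacy set of $f$, $d$ is a fixed distance on $X$ (compatible with the manifold structure), and a finite family of charts of $X$ is fixed. In a chart one uses the norm $\|x\|=\max(|x_1|,\dots,|x_k|)$, in orthonormal linear coordinates; $B_k(x,\delta)$ is the ball of center $x$ and radius $\delta$ in a chart, and $X_k^\delta$ is the set of all such balls $B_k(x,\delta)\subset X$. For $n\in\mathbb{N}$ let $X_0^{\delta,n}=\{x\in X: f^j(x)\in X\setminus I\text{ for all }0\le j\le n-1\}$ (independent of $\delta$). A set $E\subset X_0^{\delta,n}$ is $(n,\delta)$-separated if $\max_{0\le i\le n-1}d(f^i(x),f^i(y))\ge\delta$ for all $x\ne y$ in $E$. The topological entropy of $f$ is $$h_{top}(f)=\lim_{\delta\to0}\limsup_{n\to\infty}\frac1n\log\max\{\#E:\ E\subset X_0^{\delta,n}\ (n,\delta)\text{-separated}\}.$$ The $(k,0)$-topological entropy is $$h^{top}_{(k,0)}(f)=\limsup_{\delta\to0}\ \limsup_{n\to\infty}\frac1n\log\sup_{\Delta\in X_k^\delta}\max\{\#E:\ E\subset X_0^{\delta,n}\ (n,\delta)\text{-separated},\ E\subset f^{-n}(\Delta)\},$$ where $E\subset f^{-n}(\Delta)$ means $f^n(x)\in\Delta$ for all $x\in E$. *)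

theory Defs
  imports "HOL-Analysis.Analysis" "HOL-Library.Extended_Nat"
begin

section \<open>Complex manifolds\<close>

text \<open>Holomorphy in several variables: Frechet differentiability (over the reals) with
  complex-linear derivative. Only used on open sets.\<close>

definition holo_on :: "(complex^'n::finite \<Rightarrow> complex) \<Rightarrow> (complex^'n) set \<Rightarrow> bool" where
  "holo_on F S \<longleftrightarrow>
     (\<forall>z\<in>S. \<exists>D. (F has_derivative D) (at z) \<and> (\<forall>c v. D (c *s v) = c * D v))"

definition holo_vec_on :: "(complex^'n::finite \<Rightarrow> complex^'m::finite) \<Rightarrow> (complex^'n) set \<Rightarrow> bool" where
  "holo_vec_on F S \<longleftrightarrow> (\<forall>i. holo_on (\<lambda>z. F z $ i) S)"

text \<open>A chart is a pair (U, \<phi>) of a domain and a coordinate map; the values of \<phi> outside U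
  are irrelevant. The complex dimension is the cardinality of the index type.\<close>

type_synonym ('a, 'n) chart = "'a set \<times> ('a \<Rightarrow> complex^'n)"

definition coord_chart :: "'a topology \<Rightarrow> ('a, 'n::finite) chart \<Rightarrow> bool" where
  "coord_chart X = (\<lambda>(U, \<phi>).
     openin X U \<and> open (\<phi> ` U) \<and>
     homeomorphic_map (subtopology X U) (top_of_set (\<phi> ` U)) \<phi>)"

definition holo_compatible :: "('a, 'n::finite) chart \<Rightarrow> ('a, 'n::finite) chart \<Rightarrow> bool" where
  "holo_compatible = (\<lambda>(U, \<phi>) (V, \<psi>).
     holo_vec_on (\<psi> \<circ> inv_into U \<phi>) (\<phi> ` (U \<inter> V)) \<and>
     holo_vec_on (\<phi> \<circ> inv_into V \<psi>) (\<psi> ` (U \<inter> V)))"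

definition complex_manifold :: "'a topology \<Rightarrow> ('a, 'n::finite) chart set \<Rightarrow> bool" where
  "complex_manifold X A \<longleftrightarrow>
     Hausdorff_space X \<and> second_countable X \<and>
     (\<forall>c\<in>A. coord_chart X c) \<and> (\<Union>c\<in>A. fst c) = topspace X \<and>
     (\<forall>c\<in>A. \<forall>c'\<in>A. holo_compatible c c')"

text \<open>Membership in the maximal atlas generated by A.\<close>

definition manifold_chart :: "'a topology \<Rightarrow> ('a, 'n::finite) chart set \<Rightarrow> ('a, 'n::finite) chart \<Rightarrow> bool" where
  "manifold_chart X A c \<longleftrightarrow> coord_chart X c \<and> (\<forall>c'\<in>A. holo_compatible c c')"

text \<open>Charts of the product manifold, whose topology is \<^term>\<open>prod_topology X Y\<close>.\<close>

definition prod_chart :: "('a, 'n::finite) chart \<Rightarrow> ('b, 'm::finite) chart \<Rightarrow> ('a \<times> 'b, 'n + 'm) chart" where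
  "prod_chart c c' =
     (fst c \<times> fst c',
      \<lambda>(x, y). \<chi> i. case i of Inl j \<Rightarrow> snd c x $ j | Inr j \<Rightarrow> snd c' y $ j)"

definition prod_atlas ::
    "('a, 'n::finite) chart set \<Rightarrow> ('b, 'm::finite) chart set \<Rightarrow> ('a \<times> 'b, 'n + 'm) chart set" where
  "prod_atlas A B = (\<lambda>(c, c'). prod_chart c c') ` (A \<times> B)"

text \<open>Holomorphic functions and maps on an open subset W of a manifold.\<close>

definition holo_fun :: "('a, 'n::finite) chart set \<Rightarrow> 'a set \<Rightarrow> ('a \<Rightarrow> complex) \<Rightarrow> bool" where
  "holo_fun A W h \<longleftrightarrow> (\<forall>(U, \<phi>)\<in>A. holo_on (h \<circ> inv_into U \<phi>) (\<phi> ` (U \<inter> W)))"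

definition holo_map ::
    "'a topology \<Rightarrow> ('a, 'n::finite) chart set \<Rightarrow> 'b topology \<Rightarrow> ('b, 'm::finite) chart set \<Rightarrow>
     'a set \<Rightarrow> ('a \<Rightarrow> 'b) \<Rightarrow> bool" where
  "holo_map X A Y B W g \<longleftrightarrow>
     continuous_map (subtopology X W) Y g \<and>
     (\<forall>(U, \<phi>)\<in>A. \<forall>(V, \<psi>)\<in>B.
        holo_vec_on (\<psi> \<circ> g \<circ> inv_into U \<phi>) (\<phi> ` {x \<in> U \<inter> W. g x \<in> V}))"

text \<open>Local common zero sets of finitely many holomorphic functions; the condition is imposed
  at every point of the manifold, so analytic subsets are closed.\<close>

definition analytic_subset :: "'a topology \<Rightarrow> ('a, 'n::finite) chart set \<Rightarrow> 'a set \<Rightarrow> bool" where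
  "analytic_subset X A Z \<longleftrightarrow>
     Z \<subseteq> topspace X \<and>
     (\<forall>p\<in>topspace X. \<exists>W H. openin X W \<and> p \<in> W \<and> finite H \<and>
        (\<forall>h\<in>H. holo_fun A W h) \<and> Z \<inter> W = {q \<in> W. \<forall>h\<in>H. h q = 0})"


section \<open>Meromorphic self-maps of a compact complex manifold\<close>

definition map_graph :: "'a topology \<Rightarrow> ('a \<Rightarrow> 'a) \<Rightarrow> 'a set \<Rightarrow> ('a \<times> 'a) set" where
  "map_graph X f I =
     prod_topology X X closure_of {(x, f x) | x. x \<in> topspace X - I}"

text \<open>A meromorphic map is a holomorphic map off a nowhere dense analytic set such that the
  closure of its graph is analytic in the product (Remmert). The last condition says that no
  point of I is removable, so that I is exactly the indeterminacy set. The values of f on I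
  carry no information.\<close>

definition meromorphic_map ::
    "'a topology \<Rightarrow> ('a, 'n::finite) chart set \<Rightarrow> ('a \<Rightarrow> 'a) \<Rightarrow> 'a set \<Rightarrow> bool" where
  "meromorphic_map X A f I \<longleftrightarrow>
     analytic_subset X A I \<and> X interior_of I = {} \<and>
     holo_map X A X A (topspace X - I) f \<and>
     analytic_subset (prod_topology X X) (prod_atlas A A) (map_graph X f I) \<and>
     (\<forall>p\<in>I. \<nexists>W g. openin X W \<and> p \<in> W \<and> holo_map X A X A W g \<and> (\<forall>q\<in>W - I. g q = f q))"

text \<open>The second projection of the graph is onto.\<close>

definition dominating :: "'a topology \<Rightarrow> ('a \<Rightarrow> 'a) \<Rightarrow> 'a set \<Rightarrow> bool" where
  "dominating X f I \<longleftrightarrow> snd ` map_graph X f I = topspace X"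


section \<open>Entropies\<close>

text \<open>Cardinality and logarithm with values in the extended numbers; the logarithm of 0 is
  minus infinity.\<close>

definition ecard :: "'a set \<Rightarrow> enat" where
  "ecard E = (if finite E then enat (card E) else \<infinity>)"

definition elog :: "enat \<Rightarrow> ereal" where
  "elog N = (case N of enat m \<Rightarrow> (if m = 0 then -\<infinity> else ereal (ln (real m))) | \<infinity> \<Rightarrow> \<infinity>)"

definition max_norm :: "complex^'n::finite \<Rightarrow> real" where
  "max_norm z = (MAX i. cmod (z $ i))"

text \<open>The balls of radius \<delta> in the charts of the family C; the ball has to lie inside the image
  of the chart.\<close>

definition chart_balls :: "('a, 'n::finite) chart set \<Rightarrow> real \<Rightarrow> 'a set set" where
  "chart_balls C \<delta> =
     {{y \<in> U. max_norm (\<phi> y - \<phi> x) < \<delta>} | U \<phi> x.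
        (U, \<phi>) \<in> C \<and> x \<in> U \<and> {z. max_norm (z - \<phi> x) < \<delta>} \<subseteq> \<phi> ` U}"

text \<open>Points whose first n iterates avoid I. On this set the n-th iterate of the total function f
  does not depend on the values of f on I.\<close>

definition orbit_dom :: "'a topology \<Rightarrow> ('a \<Rightarrow> 'a) \<Rightarrow> 'a set \<Rightarrow> nat \<Rightarrow> 'a set" where
  "orbit_dom X f I n = {x \<in> topspace X. \<forall>j<n. (f ^^ j) x \<in> topspace X - I}"

text \<open>For n = 0 the maximum below is over the empty set; this value of n plays no role in the
  limits.\<close>

definition n_separated ::
    "'a topology \<Rightarrow> ('a \<Rightarrow> 'a \<Rightarrow> real) \<Rightarrow> ('a \<Rightarrow> 'a) \<Rightarrow> 'a set \<Rightarrow> nat \<Rightarrow> real \<Rightarrow> 'a set \<Rightarrow> bool" where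
  "n_separated X d f I n \<delta> E \<longleftrightarrow>
     E \<subseteq> orbit_dom X f I n \<and>
     (\<forall>x\<in>E. \<forall>y\<in>E. x \<noteq> y \<longrightarrow> (MAX i\<in>{..<n}. d ((f ^^ i) x) ((f ^^ i) y)) \<ge> \<delta>)"

text \<open>The maxima of cardinalities are written as suprema of extended naturals, which makes
  sense without knowing beforehand that the cardinalities are bounded.\<close>

definition h_top ::
    "'a topology \<Rightarrow> ('a \<Rightarrow> 'a \<Rightarrow> real) \<Rightarrow> ('a \<Rightarrow> 'a) \<Rightarrow> 'a set \<Rightarrow> ereal" where
  "h_top X d f I =
     Lim (at_right 0) (\<lambda>\<delta>::real. limsup (\<lambda>n.
       ereal (1 / real n) * elog (SUP E\<in>{E. n_separated X d f I n \<delta> E}. ecard E)))"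

definition h_top_k0 ::
    "'a topology \<Rightarrow> ('a \<Rightarrow> 'a \<Rightarrow> real) \<Rightarrow> ('a, 'n::finite) chart set \<Rightarrow> ('a \<Rightarrow> 'a) \<Rightarrow> 'a set \<Rightarrow> ereal" where
  "h_top_k0 X d C f I =
     Limsup (at_right 0) (\<lambda>\<delta>::real. limsup (\<lambda>n.
       ereal (1 / real n) *
         elog (SUP \<Delta>\<in>chart_balls C \<delta>.
           SUP E\<in>{E. n_separated X d f I n \<delta> E \<and> (\<forall>x\<in>E. (f ^^ n) x \<in> \<Delta>)}. ecard E)))"

end

theory Submission
  imports Defs
begin

text \<open>Fix a small radius \<open>\<delta>\<close>. By compactness, finitely many chart balls of radius \<open>\<delta>\<close>, say
  \<open>M\<close> of them, cover the manifold; this number depends on \<open>\<delta>\<close> but not on \<open>n\<close>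
  (\<open>finite_chart_ball_cover\<close>). Sorting the points of an \<open>(n, \<delta>)\<close>-separated set according to
  the ball that contains their \<open>n\<close>-th iterate splits it into at most \<open>M\<close> parts, each of which
  competes in the supremum that defines the \<open>(k,0)\<close>-entropy. So the two counting functions
  differ by a factor between \<open>1\<close> and \<open>M\<close>, and since \<open>ln M / n\<close> tends to \<open>0\<close> they have the same
  exponential growth rate in \<open>n\<close>, for every small \<open>\<delta>\<close> separately (\<open>growth_rate_eq\<close>).

  It remains to compare the limit in \<open>\<delta>\<close> with the upper limit. The number of separated points
  can only increase when \<open>\<delta>\<close> decreases, so the limit that defines the topological entropy exists
  in the extended reals (\<open>antimono_tendsto_at_right\<close>) and agrees with the upper limit.\<close>


section \<open>Cardinalities and logarithms with extended values\<close>

lemma ecard_mono: "A \<subseteq> B \<Longrightarrow> ecard A \<le> ecard B"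
  by (auto simp: ecard_def card_mono dest: finite_subset)

lemma ecard_Un_le: "ecard (A \<union> B) \<le> ecard A + ecard B"
  by (auto simp: ecard_def card_Un_le)

lemma ecard_UN_le:
  assumes "finite F" and "\<And>i. i \<in> F \<Longrightarrow> ecard (S i) \<le> b"
  shows "ecard (\<Union>i\<in>F. S i) \<le> enat (card F) * b"
  using assms
proof (induction F)
  case empty
  show ?case by (simp add: ecard_def flip: zero_enat_def)
next
  case (insert i F)
  have "ecard (\<Union>j\<in>insert i F. S j) \<le> ecard (S i) + ecard (\<Union>j\<in>F. S j)"
    using ecard_Un_le by simp
  also have "\<dots> \<le> b + enat (card F) * b"
    using insert by (intro add_mono) auto
  also have "\<dots> = (1 + enat (card F)) * b"
    by (simp add: distrib_right)
  also have "1 + enat (card F) = enat (card (insert i F))"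
    using insert by (simp add: one_enat_def)
  finally show ?case .
qed

lemma elog_mono: "M \<le> N \<Longrightarrow> elog M \<le> elog N"
  by (cases M; cases N) (auto simp: elog_def)

text \<open>For \<open>M = 0\<close> this holds because the left-hand side is minus infinity, while \<open>ln 0 = 0\<close> keeps
  the first summand on the right finite.\<close>

lemma elog_mult_le: "elog (enat M * N) \<le> ereal (ln (real M)) + elog N"
proof (cases "M = 0")
  case True
  then have "elog (enat M * N) = -\<infinity>"
    by (simp add: elog_def enat_0_iff flip: zero_enat_def) (simp add: zero_enat_def)
  then show ?thesis by simp
next
  case False
  then show ?thesis
    by (cases N) (auto simp: elog_def ln_mult imult_is_infinity zero_enat_def)
qed

text \<open>A bounded factor does not change an exponential growth rate.\<close>

lemma limsup_elog_mult_le: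
  fixes S T :: "nat \<Rightarrow> enat"
  assumes "\<And>n. T n \<le> enat M * S n"
  shows "limsup (\<lambda>n. ereal (1 / real n) * elog (T n))
         \<le> limsup (\<lambda>n. ereal (1 / real n) * elog (S n))"
proof -
  have "ereal (1 / real n) * elog (T n)
        \<le> ereal (ln (real M) / real n) + ereal (1 / real n) * elog (S n)" for n
  proof -
    have "ereal (1 / real n) * elog (T n)
          \<le> ereal (1 / real n) * (ereal (ln (real M)) + elog (S n))"
      using elog_mono[OF assms] elog_mult_le
      by (intro ereal_mult_left_mono) (auto intro: order_trans)
    also have "\<dots> = ereal (ln (real M) / real n) + ereal (1 / real n) * elog (S n)"
      by (cases "elog (S n)") (auto simp: distrib_left add_divide_distrib)
    finally show ?thesis .
  qed
  then have "limsup (\<lambda>n. ereal (1 / real n) * elog (T n))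
      \<le> limsup (\<lambda>n. ereal (ln (real M) / real n) + ereal (1 / real n) * elog (S n))"
    by (intro Limsup_mono always_eventually) simp
  also have "\<dots> = 0 + limsup (\<lambda>n. ereal (1 / real n) * elog (S n))"
  proof (rule ereal_limsup_lim_add)
    have "(\<lambda>n. ln (real M) / real n) \<longlonglongrightarrow> 0"
      by (rule lim_const_over_n)
    then show "(\<lambda>n. ereal (ln (real M) / real n)) \<longlonglongrightarrow> 0"
      by (simp add: zero_ereal_def)
  qed simp
  finally show ?thesis by simp
qed

lemma antimono_tendsto_at_right:
  fixes g :: "real \<Rightarrow> ereal"
  assumes anti: "\<And>x y. a < x \<Longrightarrow> x \<le> y \<Longrightarrow> g y \<le> g x"
  shows "(g \<longlongrightarrow> (SUP x\<in>{a<..}. g x)) (at_right a)"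
proof (rule order_tendstoI)
  fix c assume "c < (SUP x\<in>{a<..}. g x)"
  then obtain x where x: "a < x" "c < g x"
    by (auto simp: less_SUP_iff)
  have "\<forall>\<^sub>F y in at_right a. y \<in> {a<..<x}"
    using x(1) by (rule eventually_at_right_real)
  then show "\<forall>\<^sub>F y in at_right a. c < g y"
    by eventually_elim (use x anti in \<open>force intro: less_le_trans\<close>)
next
  fix c assume c: "(SUP x\<in>{a<..}. g x) < c"
  have "\<forall>\<^sub>F y in at_right a. a < y"
    by (simp add: eventually_at_right_less)
  then show "\<forall>\<^sub>F y in at_right a. g y < c"
    by eventually_elim (use c in \<open>auto intro: le_less_trans[OF SUP_upper]\<close>)
qed


section \<open>Chart balls\<close>

lemma max_norm_less_iff: "max_norm z < r \<longleftrightarrow> (\<forall>i. cmod (z $ i) < r)"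
  unfolding max_norm_def by (subst Max_less_iff) auto

lemma max_norm_triangle_less:
  assumes "max_norm (x - y) < r" and "max_norm (y - z) < s"
  shows "max_norm (x - z) < r + s"
  unfolding max_norm_less_iff
proof
  fix i
  have "cmod ((x - z) $ i) \<le> cmod ((x - y) $ i) + cmod ((y - z) $ i)"
    using norm_triangle_ineq[of "(x - y) $ i" "(y - z) $ i"] by simp
  then show "cmod ((x - z) $ i) < r + s"
    using assms unfolding max_norm_less_iff by (smt (verit))
qed

lemma open_max_norm_ball: "open {z. max_norm (z - c) < r}"
  unfolding max_norm_less_iff Collect_all_eq
  by (intro open_INT ballI open_Collect_less continuous_intros) simp

lemma open_contains_max_norm_ball:
  fixes S :: "(complex^'n::finite) set"
  assumes "open S" and "c \<in> S"
  obtains r where "r > 0" and "{z. max_norm (z - c) < r} \<subseteq> S"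
proof -
  obtain e where e: "e > 0" "ball c e \<subseteq> S"
    using assms open_contains_ball by blast
  let ?r = "e / real CARD('n)"
  have "dist c z < e" if z: "max_norm (z - c) < ?r" for z
  proof -
    have "dist c z \<le> (\<Sum>i\<in>UNIV. cmod ((z - c) $ i))"
      unfolding dist_commute[of c z] unfolding dist_norm norm_vec_def by (rule L2_set_le_sum) simp
    also have "\<dots> < (\<Sum>i\<in>(UNIV :: 'n set). ?r)"
      using z unfolding max_norm_less_iff by (intro sum_strict_mono) auto
    finally show ?thesis by simp
  qed
  then show ?thesis
    using e by (intro that[of ?r]) auto
qed

lemma openin_chart_ball:
  assumes "coord_chart X (U, \<phi>)"
  shows "openin X {y \<in> U. max_norm (\<phi> y - c) < r}"
proof -
  have U: "openin X U" and hom: "homeomorphic_map (subtopology X U) (top_of_set (\<phi> ` U)) \<phi>"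
    using assms by (auto simp: coord_chart_def)
  have top: "topspace (subtopology X U) = U"
    using openin_subset[OF U] by auto
  have "openin (top_of_set (\<phi> ` U)) (\<phi> ` U \<inter> {z. max_norm (z - c) < r})"
    by (intro openin_open_Int open_max_norm_ball)
  from openin_continuous_map_preimage[OF homeomorphic_imp_continuous_map[OF hom] this]
  have "openin (subtopology X U)
          {y \<in> U. \<phi> y \<in> \<phi> ` U \<inter> {z. max_norm (z - c) < r}}"
    unfolding top .
  also have "{y \<in> U. \<phi> y \<in> \<phi> ` U \<inter> {z. max_norm (z - c) < r}} = {y \<in> U. max_norm (\<phi> y - c) < r}"
    by auto
  finally show ?thesis
    using U openin_trans_full by blast
qed

text \<open>A Lebesgue number argument. Around each point there is a chart ball of some radius
  \<open>2 * r\<close>, and finitely many of the balls with half the radius cover the space. A ball whose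
  radius is smaller than all the finitely many \<open>r\<close> and whose centre lies in such a half ball
  stays inside the chart.\<close>

lemma chart_balls_centred_everywhere:
  fixes C :: "('a, 'n::finite) chart set"
  assumes "compact_space X" and charts: "\<forall>c\<in>C. coord_chart X c"
    and cover: "(\<Union>c\<in>C. fst c) = topspace X"
  obtains \<delta>0 where "\<delta>0 > 0"
    and "\<And>\<delta> x. 0 < \<delta> \<Longrightarrow> \<delta> < \<delta>0 \<Longrightarrow> x \<in> topspace X
          \<Longrightarrow> \<exists>\<Delta>\<in>chart_balls C \<delta>. openin X \<Delta> \<and> x \<in> \<Delta>"
proof -
  have "\<exists>U \<phi> r. (U, \<phi>) \<in> C \<and> p \<in> U \<and> r > 0 \<and> {z. max_norm (z - \<phi> p) < 2 * r} \<subseteq> \<phi> ` U"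
    if p: "p \<in> topspace X" for p
  proof -
    obtain U \<phi> where U: "(U, \<phi>) \<in> C" "p \<in> U"
      using p cover by (metis UN_E prod.collapse)
    then have "open (\<phi> ` U)"
      using charts by (auto simp: coord_chart_def)
    then obtain r where "r > 0" "{z. max_norm (z - \<phi> p) < r} \<subseteq> \<phi> ` U"
      using open_contains_max_norm_ball[of "\<phi> ` U" "\<phi> p"] U by blast
    then show ?thesis
      using U by (intro exI[of _ U] exI[of _ \<phi>] exI[of _ "r / 2"]) auto
  qed
  then obtain U \<phi> r where
    chart: "\<And>p. p \<in> topspace X \<Longrightarrow> (U p, \<phi> p) \<in> C \<and> p \<in> U p" and
    rpos: "\<And>p. p \<in> topspace X \<Longrightarrow> r p > (0::real)" and
    inside: "\<And>p. p \<in> topspace X \<Longrightarrow> {z. max_norm (z - \<phi> p p) < 2 * r p} \<subseteq> \<phi> p ` U p"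
    by metis
  define V where "V p = {y \<in> U p. max_norm (\<phi> p y - \<phi> p p) < r p}" for p
  have openV: "openin X (V p)" if "p \<in> topspace X" for p
    unfolding V_def using charts chart[OF that] by (intro openin_chart_ball) auto
  have "p \<in> V p" if "p \<in> topspace X" for p
    using chart[OF that] rpos[OF that] by (auto simp: V_def max_norm_less_iff)
  then have "topspace X \<subseteq> \<Union> (V ` topspace X)"
    by blast
  then obtain \<F> where "finite \<F>" "\<F> \<subseteq> V ` topspace X" "topspace X \<subseteq> \<Union>\<F>"
    using assms(1) openV unfolding compact_space_alt by (metis imageE)
  then obtain P where P: "finite P" "P \<subseteq> topspace X" "topspace X \<subseteq> (\<Union>p\<in>P. V p)"
    by (metis finite_subset_image)
  \<comment> \<open>The extra element \<open>1\<close> makes the minimum meaningful when the manifold is empty.\<close>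
  define \<delta>0 where "\<delta>0 = Min (insert 1 (r ` P))"
  show thesis
  proof (rule that)
    show "\<delta>0 > 0"
      unfolding \<delta>0_def using P rpos by (subst Min_gr_iff) auto
  next
    fix \<delta> x assume \<delta>: "0 < \<delta>" "\<delta> < \<delta>0" and "x \<in> topspace X"
    then obtain p where p: "p \<in> P" "x \<in> V p"
      using P by blast
    then have pX: "p \<in> topspace X" and "\<delta> < r p"
      using P \<delta> by (auto simp: \<delta>0_def)
    have "z \<in> \<phi> p ` U p" if "max_norm (z - \<phi> p x) < \<delta>" for z
      using max_norm_triangle_less[of z "\<phi> p x" "r p" "\<phi> p p" "r p"] that p \<open>\<delta> < r p\<close> inside[OF pX]
      by (auto simp: V_def)
    then have "{y \<in> U p. max_norm (\<phi> p y - \<phi> p x) < \<delta>} \<in> chart_balls C \<delta>"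
      unfolding chart_balls_def using chart[OF pX] p unfolding V_def by blast
    moreover have "openin X {y \<in> U p. max_norm (\<phi> p y - \<phi> p x) < \<delta>}"
      using charts chart[OF pX] by (intro openin_chart_ball) auto
    moreover have "x \<in> {y \<in> U p. max_norm (\<phi> p y - \<phi> p x) < \<delta>}"
      using p \<delta> by (auto simp: V_def max_norm_less_iff)
    ultimately show "\<exists>\<Delta>\<in>chart_balls C \<delta>. openin X \<Delta> \<and> x \<in> \<Delta>"
      by blast
  qed
qed

lemma finite_chart_ball_cover:
  fixes C :: "('a, 'n::finite) chart set"
  assumes "compact_space X" and "\<forall>c\<in>C. coord_chart X c" and "(\<Union>c\<in>C. fst c) = topspace X"
  shows "\<forall>\<^sub>F \<delta> in at_right 0. \<exists>F. finite F \<and> F \<subseteq> chart_balls C \<delta> \<and> topspace X \<subseteq> \<Union>F"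
proof -
  obtain \<delta>0 where \<delta>0: "\<delta>0 > 0"
    "\<And>\<delta> x. 0 < \<delta> \<Longrightarrow> \<delta> < \<delta>0 \<Longrightarrow> x \<in> topspace X
      \<Longrightarrow> \<exists>\<Delta>\<in>chart_balls C \<delta>. openin X \<Delta> \<and> x \<in> \<Delta>"
    using chart_balls_centred_everywhere[OF assms] by blast
  have "\<forall>\<^sub>F \<delta> in at_right 0. \<delta> \<in> {0<..<\<delta>0}"
    using \<delta>0(1) by (rule eventually_at_right_real)
  then show ?thesis
  proof eventually_elim
    case (elim \<delta>)
    let ?\<U> = "{\<Delta> \<in> chart_balls C \<delta>. openin X \<Delta>}"
    have "topspace X \<subseteq> \<Union>?\<U>"
      using \<delta>0(2)[of \<delta>] elim by fastforce
    moreover have "\<forall>\<Delta>\<in>?\<U>. openin X \<Delta>"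
      by blast
    ultimately obtain F where "finite F" "F \<subseteq> ?\<U>" "topspace X \<subseteq> \<Union>F"
      using assms(1) unfolding compact_space_alt by meson
    then show ?case by blast
  qed
qed


section \<open>Counting separated sets\<close>

lemma n_separated_subset:
  "n_separated X d f I n \<delta> E \<Longrightarrow> E' \<subseteq> E \<Longrightarrow> n_separated X d f I n \<delta> E'"
  by (auto simp: n_separated_def)

lemma n_separated_antimono:
  "n_separated X d f I n \<delta> E \<Longrightarrow> \<delta>' \<le> \<delta> \<Longrightarrow> n_separated X d f I n \<delta>' E"
  by (force simp: n_separated_def)

lemma iterate_in_topspace:
  assumes "f ` (topspace X - I) \<subseteq> topspace X" and "x \<in> orbit_dom X f I n"
  shows "(f ^^ n) x \<in> topspace X"
  using assms by (cases n) (auto simp: orbit_dom_def)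

text \<open>The upper bound is the pigeonhole principle: a separated set is the union of its parts whose
  \<open>n\<close>-th iterates lie in a given member of the finite cover.\<close>

lemma growth_rate_eq:
  assumes maps: "f ` (topspace X - I) \<subseteq> topspace X"
    and F: "finite F" "F \<subseteq> \<B>" "topspace X \<subseteq> \<Union>F"
  shows "limsup (\<lambda>n. ereal (1 / real n) *
           elog (SUP \<Delta>\<in>\<B>.
             SUP E\<in>{E. n_separated X d f I n \<delta> E \<and> (\<forall>x\<in>E. (f ^^ n) x \<in> \<Delta>)}. ecard E))
         = limsup (\<lambda>n. ereal (1 / real n) * elog (SUP E\<in>{E. n_separated X d f I n \<delta> E}. ecard E))"
    (is "limsup (\<lambda>n. _ * elog (?S n)) = limsup (\<lambda>n. _ * elog (?T n))")
proof (rule antisym)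
  have "?S n \<le> ?T n" for n
    by (intro SUP_least) (auto intro: SUP_upper)
  then show "limsup (\<lambda>n. ereal (1 / real n) * elog (?S n))
             \<le> limsup (\<lambda>n. ereal (1 / real n) * elog (?T n))"
    by (intro Limsup_mono always_eventually allI ereal_mult_left_mono elog_mono) auto
next
  have "?T n \<le> enat (card F) * ?S n" for n
  proof (rule SUP_least)
    fix E assume "E \<in> {E. n_separated X d f I n \<delta> E}"
    then have E: "n_separated X d f I n \<delta> E" by simp
    let ?E = "\<lambda>\<Delta>. {x \<in> E. (f ^^ n) x \<in> \<Delta>}"
    have "E \<subseteq> (\<Union>\<Delta>\<in>F. ?E \<Delta>)"
    proof
      fix x assume "x \<in> E"
      then have "(f ^^ n) x \<in> topspace X"
        using E maps by (intro iterate_in_topspace) (auto simp: n_separated_def)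
      then show "x \<in> (\<Union>\<Delta>\<in>F. ?E \<Delta>)"
        using F \<open>x \<in> E\<close> by blast
    qed
    then have "ecard E \<le> ecard (\<Union>\<Delta>\<in>F. ?E \<Delta>)"
      by (rule ecard_mono)
    also have "\<dots> \<le> enat (card F) * ?S n"
    proof (rule ecard_UN_le[OF F(1)])
      fix \<Delta> assume "\<Delta> \<in> F"
      have "ecard (?E \<Delta>) \<le>
            (SUP E\<in>{E. n_separated X d f I n \<delta> E \<and> (\<forall>x\<in>E. (f ^^ n) x \<in> \<Delta>)}. ecard E)"
        using n_separated_subset[OF E, of "?E \<Delta>"] by (intro SUP_upper) auto
      also have "\<dots> \<le> ?S n"
        using \<open>\<Delta> \<in> F\<close> F(2) by (intro SUP_upper) auto
      finally show "ecard (?E \<Delta>) \<le> ?S n" .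
    qed
    finally show "ecard E \<le> enat (card F) * ?S n" .
  qed
  then show "limsup (\<lambda>n. ereal (1 / real n) * elog (?T n))
             \<le> limsup (\<lambda>n. ereal (1 / real n) * elog (?S n))"
    by (rule limsup_elog_mult_le)
qed


section \<open>Equality of the entropies\<close>

theorem proposition0p1:
  fixes X :: "'a topology"
    and A C :: "('a, 'k::finite) chart set"
    and d :: "'a \<Rightarrow> 'a \<Rightarrow> real"
    and f :: "'a \<Rightarrow> 'a"
    and I :: "'a set"
  assumes "complex_manifold X A" and "compact_space X"
    and "Metric_space (topspace X) d" and "Metric_space.mtopology (topspace X) d = X"
    and "finite C" and "\<forall>c\<in>C. manifold_chart X A c" and "(\<Union>c\<in>C. fst c) = topspace X"
    and "meromorphic_map X A f I" and "dominating X f I"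
  shows "h_top_k0 X d C f I = h_top X d f I"
proof -
  define g where "g \<delta> = limsup (\<lambda>n. ereal (1 / real n) *
      elog (SUP E\<in>{E. n_separated X d f I n \<delta> E}. ecard E))" for \<delta> :: real
  have "g \<delta> \<le> g \<delta>'" if "\<delta>' \<le> \<delta>" for \<delta> \<delta>'
    unfolding g_def using n_separated_antimono[OF _ that]
    by (intro Limsup_mono always_eventually allI ereal_mult_left_mono elog_mono SUP_subset_mono)
      auto
  then have lim: "(g \<longlongrightarrow> (SUP \<delta>\<in>{0<..}. g \<delta>)) (at_right 0)"
    by (intro antimono_tendsto_at_right)
  have maps: "f ` (topspace X - I) \<subseteq> topspace X"
    using assms(8) continuous_map_image_subset_topspace
    unfolding meromorphic_map_def holo_map_def by fastforce
  have "\<forall>\<^sub>F \<delta> in at_right 0. \<exists>F. finite F \<and> F \<subseteq> chart_balls C \<delta> \<and> topspace X \<subseteq> \<Union>F"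
    using assms by (intro finite_chart_ball_cover) (auto simp: manifold_chart_def)
  then have "\<forall>\<^sub>F \<delta> in at_right 0. limsup (\<lambda>n. ereal (1 / real n) *
      elog (SUP \<Delta>\<in>chart_balls C \<delta>.
        SUP E\<in>{E. n_separated X d f I n \<delta> E \<and> (\<forall>x\<in>E. (f ^^ n) x \<in> \<Delta>)}. ecard E)) = g \<delta>"
    unfolding g_def by eventually_elim (use growth_rate_eq[OF maps] in blast)
  then have "h_top_k0 X d C f I = Limsup (at_right 0) g"
    unfolding h_top_k0_def by (rule Limsup_eq)
  also have "\<dots> = (SUP \<delta>\<in>{0<..}. g \<delta>)"
    using lim by (intro lim_imp_Limsup) auto
  also have "\<dots> = Lim (at_right 0) g"
    using lim by (intro tendsto_Lim[symmetric]) auto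
  also have "\<dots> = h_top X d f I"
    unfolding h_top_def g_def ..
  finally show ?thesis .
qed

end
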